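(* Let $\nu>-1$, $t>0$, $0<\lambda<1$, and let $A_n,B_n$ be the three-term recurrence coefficients of the orthonormal polynomials $P_n(x;t,\lambda)$ with respect to the weight $\omega_k=\rho_{k+\nu+1}(t)\lambda^k/k!$, $k\in\mathbb{N}_0$. Then they satisfy the Toda system in $\lambda$: $$\lambda\frac{\partial B_n}{\partial\lambda}=A_{n+1}^2-A_n^2\quad(n\ge0),\qquad \lambda\frac{\partial A_n^2}{\partial\lambda}=A_n^2\left(B_n-B_{n-1}\right)\quad(n\ge1).$$
   Context: For $t>0$ and real $\mu$, $\rho_\mu(t)=2t^{\mu/2}K_\mu(2\sqrt t)$, where $K_\mu$ is the modified Bessel (Macdonald) function; for $\mu>0$, $\rho_\mu(t)=\int_0^\infty e^{-t/x-x}x^{\mu-1}dx$. The polynomials $P_n(x;t,\lambda)=a_nx^n+b_nx^{n-1}+\dots$ have real coefficients depending on $t,\lambda$ (and $\nu$), $\deg P_n=n$, and satisfy $\sum_{k=0}^\infty P_n(k;t,\lambda)P_m(k;t,\lambda)\,\omega_k=\delta_{n,m}$ for all $n,m\in\mathbb{N}_0$. They satisfy $xP_n=A_{n+1}P_{n+1}+B_nP_n+A_nP_{n-1}$ with $A_n=a_{n-1}/a_n$, $B_n=b_n/a_n-b_{n+1}/a_{n+1}$; conventions: $P_{-1}\equiv0$, $A_0=0$, $b_0=0$. Standing assumption: the coefficients of the $P_n$ are $C^1$ functions of $(t,\lambda)$ for $t>0$, $0<\lambda<1$. *)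

theory Defs
  imports "HOL-Analysis.Analysis" "HOL-Computational_Algebra.Polynomial"
begin

text \<open>
  The modified Bessel function of the second kind (Macdonald function) of real order, on
  \<open>z > 0\<close>, by its standard integral representation, valid for every real order (DLMF 10.32.9).
\<close>

definition macdonald :: "real \<Rightarrow> real \<Rightarrow> real" where
  "macdonald \<mu> z = integral {0..} (\<lambda>u. exp (- z * cosh u) * cosh (\<mu> * u))"

definition rho :: "real \<Rightarrow> real \<Rightarrow> real" where
  "rho \<mu> t = 2 * t powr (\<mu> / 2) * macdonald \<mu> (2 * sqrt t)"

text \<open>Consistency with the other usual description of \<open>rho\<close>, valid for positive order.\<close>

lemma rho_integral:
  assumes t: "t > 0" and mu: "\<mu> > 0"
  shows "((\<lambda>x. exp (- t / x - x) * x powr (\<mu> - 1)) has_integral rho \<mu> t) {0<..}"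
proof -
  define f where "f = (\<lambda>x. exp (- t / x - x) * x powr (\<mu> - 1))"
  define h where "h = (\<lambda>u. t powr (\<mu> / 2) * (exp (- (2 * sqrt t) * cosh u) * exp (\<mu> * u)))"
  have "(\<lambda>x. x powr (\<mu> - 1) / exp x) integrable_on {0..}"
    using Gamma_integral_real[OF mu] by blast
  then have gint: "(\<lambda>x. x powr (\<mu> - 1) / exp x) integrable_on {0<..}"
    by (rule integrable_spike_set) (auto intro: negligible_subset[of "{0}"])
  have "f absolutely_integrable_on {0<..}"
  proof (rule measurable_bounded_by_integrable_imp_absolutely_integrable[OF _ _ gint])
    have "continuous_on {0<..} f"
      unfolding f_def by (intro continuous_intros) auto
    then show "f \<in> borel_measurable (lebesgue_on {0<..})"
      by (intro continuous_imp_measurable_on_sets_lebesgue) auto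
  next
    fix x :: real assume "x \<in> {0<..}"
    then have "exp (- t / x - x) \<le> exp (- x)" using t by simp
    then have "f x \<le> exp (- x) * x powr (\<mu> - 1)"
      unfolding f_def by (rule mult_right_mono) simp
    then show "norm (f x) \<le> x powr (\<mu> - 1) / exp x"
      by (simp add: f_def exp_minus divide_inverse mult.commute)
  qed auto
  moreover have im: "range (\<lambda>u. sqrt t * exp u) = {0<..}"
  proof -
    have "x \<in> range (\<lambda>u. sqrt t * exp u)" if "x > 0" for x
      using that t by (intro image_eqI[of _ _ "ln (x / sqrt t)"]) auto
    then show ?thesis using t by auto
  qed
  moreover have cov: "\<bar>sqrt t * exp u\<bar> * f (sqrt t * exp u) = h u" for u
  proof -
    have s: "t / (sqrt t * exp u) = sqrt t * exp (- u)"
      using t by (simp add: exp_minus field_simps)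
    have "\<bar>sqrt t * exp u\<bar> * (sqrt t * exp u) powr (\<mu> - 1) = (sqrt t * exp u) powr \<mu>"
      using t by (simp add: powr_diff)
    also have "\<dots> = t powr (\<mu> / 2) * exp (\<mu> * u)"
      using t by (simp add: powr_mult powr_powr powr_half_sqrt[symmetric] exp_powr_real mult.commute)
    finally have p: "\<bar>sqrt t * exp u\<bar> * (sqrt t * exp u) powr (\<mu> - 1)
                       = t powr (\<mu> / 2) * exp (\<mu> * u)" .
    have "- t / (sqrt t * exp u) - sqrt t * exp u = - (2 * sqrt t) * cosh u"
      using s by (simp add: cosh_def algebra_simps)
    then have "\<bar>sqrt t * exp u\<bar> * f (sqrt t * exp u) =
       exp (- (2 * sqrt t) * cosh u) * (\<bar>sqrt t * exp u\<bar> * (sqrt t * exp u) powr (\<mu> - 1))"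
      unfolding f_def by (simp only: mult_ac)
    then show ?thesis unfolding p h_def by (simp only: mult_ac)
  qed
  moreover have "(\<lambda>u. \<bar>sqrt t * exp u\<bar> * f (sqrt t * exp u)) absolutely_integrable_on UNIV \<and>
      integral UNIV (\<lambda>u. \<bar>sqrt t * exp u\<bar> * f (sqrt t * exp u)) = b \<longleftrightarrow>
      f absolutely_integrable_on range (\<lambda>u. sqrt t * exp u) \<and>
      integral (range (\<lambda>u. sqrt t * exp u)) f = b" for b
    using t by (intro has_absolute_integral_change_of_variables_1')
       (auto intro!: derivative_eq_intros injI)
  ultimately have h: "h absolutely_integrable_on UNIV" "integral UNIV h = integral {0<..} f"
    and f: "f integrable_on {0<..}"
    by (auto simp: set_lebesgue_integral_eq_integral)
  have hp: "h absolutely_integrable_on {0..}" and hm: "h absolutely_integrable_on {..0}"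
    using h(1) by (auto intro: set_integrable_subset)
  have refl: "(\<lambda>u. h (- u)) absolutely_integrable_on {0..} \<and>
              integral {0..} (\<lambda>u. h (- u)) = integral {..0} h"
    by (rule iffD2[OF has_absolute_integral_reflect_real]) (use hm in auto)
  have "integral UNIV h = integral ({0..} \<union> {..0}) h"
    by (rule arg_cong[where f = "\<lambda>S. integral S h"]) auto
  also have "\<dots> = integral {0..} h + integral {..0} h"
    using hp hm
    by (intro integral_Un) (auto simp: set_lebesgue_integral_eq_integral
          intro: negligible_subset[of "{0}"])
  also have "\<dots> = integral {0..} (\<lambda>u. h u + h (- u))"
    using hp refl by (subst integral_add) (auto simp: set_lebesgue_integral_eq_integral)
  also have "(\<lambda>u. h u + h (- u)) = (\<lambda>u. 2 * t powr (\<mu> / 2) *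
                  (exp (- (2 * sqrt t) * cosh u) * cosh (\<mu> * u)))"
  proof
    fix u
    have two_cosh: "exp (\<mu> * u) + exp (\<mu> * - u) = 2 * cosh (\<mu> * u)"
      by (simp add: cosh_def)
    show "h u + h (- u) =
        2 * t powr (\<mu> / 2) * (exp (- (2 * sqrt t) * cosh u) * cosh (\<mu> * u))"
      unfolding h_def cosh_minus distrib_left[symmetric] two_cosh by (simp only: mult_ac)
  qed
  also have "integral {0..} \<dots> = rho \<mu> t"
    by (simp add: rho_def macdonald_def)
  finally show ?thesis
    using h(2) integrable_integral[OF f] unfolding f_def by simp
qed

definition weight :: "real \<Rightarrow> real \<Rightarrow> real \<Rightarrow> nat \<Rightarrow> real" where
  "weight \<nu> t l k = rho (real k + \<nu> + 1) t * l ^ k / fact k"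

definition orthonormal_polys :: "(nat \<Rightarrow> real) \<Rightarrow> (nat \<Rightarrow> real poly) \<Rightarrow> bool" where
  "orthonormal_polys w p \<longleftrightarrow>
     (\<forall>n. degree (p n) = n) \<and>
     (\<forall>n m. (\<lambda>k. poly (p n) (real k) * poly (p m) (real k) * w k) sums (if n = m then 1 else 0))"

text \<open>
  Writing \<open>p n = a\<^sub>n x\<^sup>n + b\<^sub>n x\<^sup>n\<^sup>-\<^sup>1 + \<dots>\<close>, with the conventions \<open>b\<^sub>0 = 0\<close> and \<open>A\<^sub>0 = 0\<close>, the
  coefficients in \<open>x p\<^sub>n = A\<^sub>n\<^sub>+\<^sub>1 p\<^sub>n\<^sub>+\<^sub>1 + B\<^sub>n p\<^sub>n + A\<^sub>n p\<^sub>n\<^sub>-\<^sub>1\<close> are \<open>A\<^sub>n = a\<^sub>n\<^sub>-\<^sub>1 / a\<^sub>n\<close> and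
  \<open>B\<^sub>n = b\<^sub>n / a\<^sub>n - b\<^sub>n\<^sub>+\<^sub>1 / a\<^sub>n\<^sub>+\<^sub>1\<close>.
\<close>

definition coeff_a :: "(nat \<Rightarrow> real poly) \<Rightarrow> nat \<Rightarrow> real" where
  "coeff_a p n = coeff (p n) n"

definition coeff_b :: "(nat \<Rightarrow> real poly) \<Rightarrow> nat \<Rightarrow> real" where
  "coeff_b p n = (if n = 0 then 0 else coeff (p n) (n - 1))"

definition rec_A :: "(nat \<Rightarrow> real poly) \<Rightarrow> nat \<Rightarrow> real" where
  "rec_A p n = (if n = 0 then 0 else coeff_a p (n - 1) / coeff_a p n)"

definition rec_B :: "(nat \<Rightarrow> real poly) \<Rightarrow> nat \<Rightarrow> real" where
  "rec_B p n = coeff_b p n / coeff_a p n - coeff_b p (n + 1) / coeff_a p (n + 1)"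

text \<open>The derivative is taken at \<open>x\<close>, not within \<open>S\<close>, so this is meant for open \<open>S\<close>.\<close>

definition C1_on :: "('a::real_normed_vector \<Rightarrow> 'b::real_normed_vector) \<Rightarrow> 'a set \<Rightarrow> bool" where
  "C1_on f S \<longleftrightarrow>
     (\<exists>f' :: 'a \<Rightarrow> 'a \<Rightarrow>\<^sub>L 'b.
        (\<forall>x\<in>S. (f has_derivative blinfun_apply (f' x)) (at x)) \<and> continuous_on S f')"

end

theory Submission
  imports Defs
begin

text \<open>
  Write \<open>L\<^sub>s q = (\<Sum>k. q(k) c\<^sub>k s\<^sup>k)\<close> for the functional of a weight that depends on \<open>s\<close> only through
  \<open>s\<^sup>k\<close>. Since \<open>s d/ds s\<^sup>k = k s\<^sup>k\<close>, differentiation in \<open>s\<close> is multiplication by the variable: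
  \<open>s d/ds L\<^sub>s q = L\<^sub>s (x q)\<close> for fixed \<open>q\<close> (lemma \<open>has_derivative_wsum\<close>). The Bessel
  factor does not depend on \<open>s\<close> and is absorbed in \<open>c\<^sub>k\<close>.

  Let \<open>Q\<^sub>n\<close> be the derivative of \<open>P\<^sub>n\<close> in the parameter, a polynomial of degree at most \<open>n\<close>.
  Differentiating \<open>L\<^sub>s (P\<^sub>n P\<^sub>m) = \<delta>\<^sub>n\<^sub>m\<close> gives
  \<open>s L (Q\<^sub>n P\<^sub>m) + s L (P\<^sub>n Q\<^sub>m) + L (x P\<^sub>n P\<^sub>m) = 0\<close>.
  For \<open>m = n\<close> this reads \<open>2 s L (Q\<^sub>n P\<^sub>n) = - B\<^sub>n\<close>; for \<open>m = n - 1\<close> the middle term vanishes by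
  orthogonality and \<open>s L (Q\<^sub>n P\<^sub>n\<^sub>-\<^sub>1) = - A\<^sub>n\<close>. On the other hand \<open>L (q P\<^sub>n)\<close> with \<open>degree q \<le> n + 1\<close>
  is determined by the two coefficients of \<open>q\<close> at \<open>n\<close> and \<open>n + 1\<close> (lemma \<open>wsum_mult_orthonormal\<close>), which
  identifies \<open>L (Q\<^sub>n P\<^sub>n) = a\<^sub>n' / a\<^sub>n\<close> and \<open>L (Q\<^sub>n P\<^sub>n\<^sub>-\<^sub>1) = (b\<^sub>n / a\<^sub>n)' / A\<^sub>n\<close>. Hence
  \<open>s a\<^sub>n' = - a\<^sub>n B\<^sub>n / 2\<close> and \<open>s (b\<^sub>n / a\<^sub>n)' = - A\<^sub>n\<^sup>2\<close>, and the Toda system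
  follows from \<open>A\<^sub>n = a\<^sub>n\<^sub>-\<^sub>1 / a\<^sub>n\<close> and \<open>B\<^sub>n = b\<^sub>n / a\<^sub>n - b\<^sub>n\<^sub>+\<^sub>1 / a\<^sub>n\<^sub>+\<^sub>1\<close>.
\<close>

section \<open>The functional of a discrete weight\<close>

definition wsum :: "(nat \<Rightarrow> real) \<Rightarrow> real poly \<Rightarrow> real" where
  "wsum w q = (\<Sum>k. poly q (real k) * w k)"

lemma poly_graded_expansion:
  fixes p :: "nat \<Rightarrow> 'a::field poly"
  assumes deg: "\<And>n. degree (p n) = n" and nz: "\<And>n. p n \<noteq> 0"
    and q: "\<And>i. i \<ge> N \<Longrightarrow> coeff q i = 0"
  shows "\<exists>c. q = (\<Sum>m<N. smult (c m) (p m))"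
  using q
proof (induction N arbitrary: q)
  case 0
  then show ?case by (simp add: poly_eq_iff)
next
  case (Suc N)
  define d where "d = coeff q N / coeff (p N) N"
  have lead: "coeff (p N) N \<noteq> 0"
    using nz[of N] deg[of N] leading_coeff_0_iff[of "p N"] by simp
  have "coeff (q - smult d (p N)) i = 0" if "i \<ge> N" for i
  proof (cases "i = N")
    case True
    then show ?thesis using lead by (simp add: d_def)
  next
    case False
    then show ?thesis using that Suc.prems[of i] deg[of N] by (simp add: coeff_eq_0)
  qed
  then obtain c where c: "q - smult d (p N) = (\<Sum>m<N. smult (c m) (p m))"
    using Suc.IH by blast
  have "(\<Sum>m<Suc N. smult ((c(N := d)) m) (p m)) = (\<Sum>m<N. smult (c m) (p m)) + smult d (p N)"
    by simp
  also have "\<dots> = q" by (simp flip: c)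
  finally show ?case by metis
qed

text \<open>\<open>degree (p 0) = 0\<close> leaves \<open>p 0 = 0\<close> possible; the normalization excludes it.\<close>

lemma orthonormal_polys_nonzero:
  assumes "orthonormal_polys w p"
  shows "p n \<noteq> 0"
proof
  assume "p n = 0"
  have "(\<lambda>k. poly (p n) (real k) * poly (p n) (real k) * w k) sums 1"
    using assms unfolding orthonormal_polys_def by (metis (full_types))
  with \<open>p n = 0\<close> show False using sums_unique2[OF sums_zero] by fastforce
qed

lemma coeff_a_nonzero:
  assumes "orthonormal_polys w p"
  shows "coeff_a p n \<noteq> 0"
  using orthonormal_polys_nonzero[OF assms, of n] assms
  by (metis coeff_a_def leading_coeff_0_iff orthonormal_polys_def)

text \<open>
  All moments exist because every polynomial is a combination of the products \<open>p m * p 0\<close>,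
  \<open>p 0\<close> being a nonzero constant.
\<close>

lemma orthonormal_polys_summable:
  assumes "orthonormal_polys w p"
  shows "summable (\<lambda>k. poly q (real k) * w k)"
proof -
  have deg: "degree (p n) = n" for n using assms by (simp add: orthonormal_polys_def)
  obtain e where e: "p 0 = [:e:]" using deg[of 0] degree_eq_zeroE by blast
  then have e0: "e \<noteq> 0" using orthonormal_polys_nonzero[OF assms, of 0] by auto
  have "\<exists>c. q = (\<Sum>m<Suc (degree q). smult (c m) (p m))"
    by (rule poly_graded_expansion) (simp_all add: deg orthonormal_polys_nonzero[OF assms] coeff_eq_0)
  then obtain c where c: "q = (\<Sum>m<Suc (degree q). smult (c m) (p m))" ..
  have "summable (\<lambda>k. poly (p m) (real k) * poly (p 0) (real k) * w k)" for m
    using assms unfolding orthonormal_polys_def sums_iff by blast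
  then have "summable (\<lambda>k. \<Sum>m<Suc (degree q). c m / e *
               (poly (p m) (real k) * poly (p 0) (real k) * w k))"
    by (intro summable_sum summable_mult) auto
  also have "(\<lambda>k. \<Sum>m<Suc (degree q). c m / e *
               (poly (p m) (real k) * poly (p 0) (real k) * w k)) =
             (\<lambda>k. poly (\<Sum>m<Suc (degree q). smult (c m) (p m)) (real k) * w k)"
    using e0 by (simp only: poly_sum sum_distrib_right) (simp add: e mult_ac)
  finally show ?thesis by (simp only: c[symmetric])
qed

lemma wsum_add:
  assumes "orthonormal_polys w p"
  shows "wsum w (q + r) = wsum w q + wsum w r"
  using suminf_add[OF orthonormal_polys_summable[OF assms, of q]
                      orthonormal_polys_summable[OF assms, of r]]
  by (simp add: wsum_def distrib_right)

lemma wsum_smult: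
  assumes "orthonormal_polys w p"
  shows "wsum w (smult a q) = a * wsum w q"
  using suminf_mult[OF orthonormal_polys_summable[OF assms, of q], of a]
  by (simp add: wsum_def mult.assoc)

lemma wsum_sum:
  assumes "orthonormal_polys w p"
  shows "wsum w (\<Sum>i\<in>I. f i) = (\<Sum>i\<in>I. wsum w (f i))"
  by (induction I rule: infinite_finite_induct) (auto simp: wsum_add[OF assms] wsum_def[of _ 0])

lemma wsum_orthonormal:
  assumes "orthonormal_polys w p"
  shows "wsum w (p n * p m) = (if n = m then 1 else 0)"
  unfolding wsum_def poly_mult
  by (rule sums_unique[symmetric]) (use assms in \<open>simp only: orthonormal_polys_def\<close>)

text \<open>
  Only the coefficient of \<open>p n\<close> in the expansion of \<open>q\<close> contributes, and it is found by
  eliminating \<open>p (n + 1)\<close> from the two top coefficients of \<open>q\<close>. Every inner product that the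
  proof of the Toda system evaluates is an instance.
\<close>

lemma wsum_mult_orthonormal:
  assumes orth: "orthonormal_polys w p" and q: "\<And>i. i > n + 1 \<Longrightarrow> coeff q i = 0"
  shows "wsum w (q * p n) =
    (coeff q n - coeff q (n + 1) * (coeff_b p (n + 1) / coeff_a p (n + 1))) / coeff_a p n"
proof -
  have deg: "degree (p n) = n" for n using orth by (simp add: orthonormal_polys_def)
  note a = coeff_a_nonzero[OF orth]
  have "\<exists>c. q = (\<Sum>m<n + 2. smult (c m) (p m))"
    by (rule poly_graded_expansion) (simp_all add: deg orthonormal_polys_nonzero[OF orth] q)
  then obtain c where c: "q = (\<Sum>m<n + 2. smult (c m) (p m))" ..
  have "wsum w (q * p n) = (\<Sum>m<n + 2. c m * wsum w (p m * p n))"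
    unfolding c sum_distrib_right wsum_sum[OF orth] mult_smult_left wsum_smult[OF orth] ..
  also have "\<dots> = (\<Sum>m<n + 2. if m = n then c m else 0)"
    by (intro sum.cong) (auto simp: wsum_orthonormal[OF orth])
  finally have l: "wsum w (q * p n) = c n" by simp
  have low: "(\<Sum>m<n. c m * coeff (p m) n) = 0" "(\<Sum>m<n. c m * coeff (p m) (Suc n)) = 0"
    by (auto intro!: sum.neutral simp: coeff_eq_0 deg)
  have "coeff q (n + 1) = c (n + 1) * coeff_a p (n + 1)"
    by (subst c) (simp add: coeff_sum low coeff_eq_0 deg coeff_a_def)
  moreover have "coeff q n = c n * coeff_a p n + c (n + 1) * coeff_b p (n + 1)"
    by (subst c) (simp add: coeff_sum low coeff_a_def coeff_b_def)
  ultimately show ?thesis using a[of n] a[of "n + 1"] by (simp only: l) simp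
qed

lemma rec_B_eq_wsum:
  assumes orth: "orthonormal_polys w p"
  shows "wsum w (pCons 0 (p n) * p n) = rec_B p n"
proof -
  have deg: "degree (p n) = n" using orth by (simp add: orthonormal_polys_def)
  have "coeff (pCons 0 (p n)) i = 0" if "i > n + 1" for i
    using that deg by (cases i) (auto simp: coeff_eq_0)
  moreover have "coeff (pCons 0 (p n)) n = coeff_b p n"
    by (cases n) (auto simp: coeff_b_def)
  ultimately show ?thesis
    using coeff_a_nonzero[OF orth, of n]
    by (subst wsum_mult_orthonormal[OF orth]) (auto simp: rec_B_def coeff_a_def diff_divide_distrib)
qed

lemma rec_A_eq_wsum:
  assumes orth: "orthonormal_polys w p"
  shows "wsum w (pCons 0 (p n) * p (n + 1)) = rec_A p (n + 1)"
proof -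
  have deg: "degree (p n) = n" using orth by (simp add: orthonormal_polys_def)
  have "coeff (pCons 0 (p n)) i = 0" if "i > n + 1" for i
    using that deg by (cases i) (auto simp: coeff_eq_0)
  then show ?thesis
    by (subst wsum_mult_orthonormal[OF orth]) (auto simp: rec_A_def coeff_a_def coeff_eq_0 deg)
qed

section \<open>Differentiation in the parameter\<close>

text \<open>
  Termwise differentiation of a power series. Convergence at every point of \<open>(0, 1)\<close>
  puts \<open>l\<close> strictly inside the disc of convergence.
\<close>

lemma has_derivative_wsum:
  assumes conv: "\<And>s q. 0 < s \<Longrightarrow> s < 1 \<Longrightarrow> summable (\<lambda>k. poly q (real k) * (c k * s ^ k))"
    and l: "0 < l" "l < 1"
  shows "((\<lambda>s. wsum (\<lambda>k. c k * s ^ k) q) has_field_derivative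
            wsum (\<lambda>k. c k * l ^ k) (pCons 0 q) / l) (at l)"
proof -
  define d where "d = (\<lambda>k. poly q (real k) * c k)"
  obtain K where K: "l < K" "K < 1" using dense l by blast
  have sK: "summable (\<lambda>k. d k * K ^ k)"
    using conv[of K q] K l by (simp add: d_def mult.assoc)
  have D: "((\<lambda>s. \<Sum>k. d k * s ^ k) has_field_derivative (\<Sum>k. diffs d k * l ^ k)) (at l)"
    using termdiffs_strong[OF sK, of l] K l by simp
  have "summable (\<lambda>k. diffs d k * l ^ k)"
  proof (rule termdiff_converges[of l K])
    show "norm l < K" using K l by simp
    show "summable (\<lambda>k. d k * x ^ k)" if "norm x < K" for x
      using powser_inside[OF sK, of x] that K l by simp
  qed
  then have "(\<lambda>k. of_nat k * d k * l ^ (k - Suc 0)) sums (\<Sum>k. diffs d k * l ^ k)"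
    by (rule diffs_equiv)
  then have "(\<lambda>k. l * (of_nat k * d k * l ^ (k - Suc 0))) sums (l * (\<Sum>k. diffs d k * l ^ k))"
    by (rule sums_mult)
  also have "(\<lambda>k. l * (of_nat k * d k * l ^ (k - Suc 0))) =
             (\<lambda>k. poly (pCons 0 q) (real k) * (c k * l ^ k))"
  proof
    show "l * (of_nat k * d k * l ^ (k - Suc 0)) =
             poly (pCons 0 q) (real k) * (c k * l ^ k)" for k
      by (cases k) (auto simp: d_def)
  qed
  finally have "wsum (\<lambda>k. c k * l ^ k) (pCons 0 q) = l * (\<Sum>k. diffs d k * l ^ k)"
    unfolding wsum_def by (rule sums_unique[symmetric])
  then show ?thesis using D l by (simp add: wsum_def d_def mult.assoc)
qed

definition has_coeff_derivative ::
    "(real \<Rightarrow> real poly) \<Rightarrow> real poly \<Rightarrow> real \<Rightarrow> bool" where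
  "has_coeff_derivative F G l \<longleftrightarrow>
     (\<forall>i. ((\<lambda>s. coeff (F s) i) has_field_derivative coeff G i) (at l))"

lemma has_coeff_derivative_mult:
  assumes "has_coeff_derivative F F' l" "has_coeff_derivative G G' l"
  shows "has_coeff_derivative (\<lambda>s. F s * G s) (F' * G l + F l * G') l"
  unfolding has_coeff_derivative_def
proof
  fix i
  have "((\<lambda>s. \<Sum>j\<le>i. coeff (F s) j * coeff (G s) (i - j)) has_field_derivative
     (\<Sum>j\<le>i. coeff (F l) j * coeff G' (i - j) + coeff F' j * coeff (G l) (i - j))) (at l)"
    using assms unfolding has_coeff_derivative_def by (intro DERIV_sum DERIV_mult') auto
  then show "((\<lambda>s. coeff (F s * G s) i) has_field_derivative
      coeff (F' * G l + F l * G') i) (at l)"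
    by (simp add: coeff_mult sum.distrib add.commute)
qed

text \<open>
  Product rule for weight and argument varying together. The uniform degree bound \<open>N\<close> reduces it to
  finitely many moments.
\<close>

lemma has_derivative_wsum_poly:
  assumes orth: "\<And>s. 0 < s \<Longrightarrow> s < 1 \<Longrightarrow> orthonormal_polys (\<lambda>k. c k * s ^ k) (p s)"
    and l: "0 < l" "l < 1"
    and F: "has_coeff_derivative F G l"
    and degF: "\<And>s. 0 < s \<Longrightarrow> s < 1 \<Longrightarrow> degree (F s) \<le> N" and degG: "degree G \<le> N"
  shows "((\<lambda>s. wsum (\<lambda>k. c k * s ^ k) (F s)) has_field_derivative
     wsum (\<lambda>k. c k * l ^ k) G + wsum (\<lambda>k. c k * l ^ k) (pCons 0 (F l)) / l) (at l)"
proof -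
  define L where "L = (\<lambda>s. wsum (\<lambda>k. c k * s ^ k))"
  define X where "X = (\<lambda>i. monom (1::real) i)"
  have expand: "q = (\<Sum>i\<le>N. smult (coeff q i) (X i))" if "degree q \<le> N" for q
    using poly_as_sum_of_monoms'[OF that] by (simp add: X_def smult_monom)
  have L_lin: "L s (\<Sum>i\<le>N. smult (a i) (f i)) = (\<Sum>i\<le>N. a i * L s (f i))"
    if "0 < s" "s < 1" for s a f
    unfolding L_def wsum_sum[OF orth[OF that]] wsum_smult[OF orth[OF that]] ..
  have mom: "((\<lambda>s. L s (X i)) has_field_derivative L l (pCons 0 (X i)) / l) (at l)" for i
    unfolding L_def using orthonormal_polys_summable[OF orth] l by (rule has_derivative_wsum)
  have shift: "pCons 0 (F l) = (\<Sum>i\<le>N. smult (coeff (F l) i) (pCons 0 (X i)))"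
  proof -
    have "pCons 0 (F l) = [:0, 1:] * (\<Sum>i\<le>N. smult (coeff (F l) i) (X i))"
      using expand[OF degF[OF l]] by simp
    then show ?thesis by (simp only: sum_distrib_left) simp
  qed
  have "((\<lambda>s. \<Sum>i\<le>N. coeff (F s) i * L s (X i)) has_field_derivative
     (\<Sum>i\<le>N. coeff G i * L l (X i) + L l (pCons 0 (X i)) / l * coeff (F l) i)) (at l)"
    using F mom unfolding has_coeff_derivative_def by (intro DERIV_sum DERIV_mult) auto
  also have "(\<Sum>i\<le>N. coeff G i * L l (X i) + L l (pCons 0 (X i)) / l * coeff (F l) i)
      = L l (\<Sum>i\<le>N. smult (coeff G i) (X i)) +
        L l (\<Sum>i\<le>N. smult (coeff (F l) i) (pCons 0 (X i))) / l"
    unfolding L_lin[OF l] by (simp add: sum.distrib sum_divide_distrib mult.commute)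
  also have "\<dots> = L l G + L l (pCons 0 (F l)) / l"
    using expand[OF degG] shift by simp
  finally have "((\<lambda>s. L s (F s)) has_field_derivative L l G + L l (pCons 0 (F l)) / l) (at l)"
  proof (rule has_field_derivative_transform_within_open[where S = "{0<..<1}"])
    show "(\<Sum>i\<le>N. coeff (F s) i * L s (X i)) = L s (F s)" if "s \<in> {0<..<1}" for s
      using L_lin[of s] expand[OF degF[of s]] that by (metis greaterThanLessThan_iff)
  qed (use l in auto)
  then show ?thesis by (simp add: L_def)
qed

section \<open>The Toda system\<close>

lemma orthonormal_coeff_derivatives:
  assumes orth: "\<And>s. 0 < s \<Longrightarrow> s < 1 \<Longrightarrow> orthonormal_polys (\<lambda>k. c k * s ^ k) (p s)"
    and dif: "\<And>n i. (\<lambda>s. coeff (p s n) i) field_differentiable at l"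
    and l: "0 < l" "l < 1"
  shows has_derivative_coeff_a:
      "((\<lambda>s. coeff_a (p s) n) has_field_derivative
          - (coeff_a (p l) n * rec_B (p l) n) / (2 * l)) (at l)"
    and has_derivative_coeff_ratio:
      "((\<lambda>s. coeff_b (p s) n / coeff_a (p s) n) has_field_derivative
          - (rec_A (p l) n)\<^sup>2 / l) (at l)"
proof -
  define L where "L = wsum (\<lambda>k. c k * l ^ k)"
  note orl = orth[OF l]
  have deg: "degree (p s n) = n" if "0 < s" "s < 1" for s n
    using orth[OF that] by (simp add: orthonormal_polys_def)
  have a: "coeff_a (p l) n \<noteq> 0" for n using coeff_a_nonzero[OF orl] .
  define Q where "Q = (\<lambda>n. \<Sum>i\<le>n. monom (deriv (\<lambda>s. coeff (p s n) i) l) i)"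
  have coeffQ: "coeff (Q n) i = (if i \<le> n then deriv (\<lambda>s. coeff (p s n) i) l else 0)" for n i
    by (simp add: Q_def coeff_sum)
  have degQ: "degree (Q n) \<le> n" for n
    by (rule degree_le) (simp add: coeffQ)
  have Q: "has_coeff_derivative (\<lambda>s. p s n) (Q n) l" for n
    unfolding has_coeff_derivative_def
  proof
    fix i
    show "((\<lambda>s. coeff (p s n) i) has_field_derivative coeff (Q n) i) (at l)"
    proof (cases "i \<le> n")
      case True
      then show ?thesis using dif by (simp add: coeffQ field_differentiable_derivI)
    next
      case False
      have "((\<lambda>s. coeff (p s n) i) has_field_derivative 0) (at l)"
        by (rule has_field_derivative_transform_within_open[where S = "{0<..<1}" and f = "\<lambda>_. 0"])
           (use l False in \<open>auto simp: coeff_eq_0 deg\<close>)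
      with False show ?thesis by (simp add: coeffQ)
    qed
  qed
  have key: "L (Q n * p l m) + L (p l n * Q m) + L (pCons 0 (p l n * p l m)) / l = 0" for n m
  proof (rule DERIV_unique)
    have "((\<lambda>s. wsum (\<lambda>k. c k * s ^ k) (p s n * p s m)) has_field_derivative
        L (Q n * p l m + p l n * Q m) + L (pCons 0 (p l n * p l m)) / l) (at l)"
      unfolding L_def
    proof (rule has_derivative_wsum_poly[where N = "n + m"])
      show "has_coeff_derivative (\<lambda>s. p s n * p s m) (Q n * p l m + p l n * Q m) l"
        by (intro has_coeff_derivative_mult Q)
      show "degree (p s n * p s m) \<le> n + m" if "0 < s" "s < 1" for s
        using degree_mult_le[of "p s n" "p s m"] deg[OF that] by simp
      have "degree (Q n * p l m) \<le> n + m"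
        using degree_mult_le[of "Q n" "p l m"] degQ[of n] deg[OF l, of m] by linarith
      moreover have "degree (p l n * Q m) \<le> n + m"
        using degree_mult_le[of "p l n" "Q m"] degQ[of m] deg[OF l, of n] by linarith
      ultimately show "degree (Q n * p l m + p l n * Q m) \<le> n + m"
        by (rule degree_add_le)
    qed (use orth l in auto)
    then show "((\<lambda>s. wsum (\<lambda>k. c k * s ^ k) (p s n * p s m)) has_field_derivative
        L (Q n * p l m) + L (p l n * Q m) + L (pCons 0 (p l n * p l m)) / l) (at l)"
      by (simp add: L_def wsum_add[OF orl])
    show "((\<lambda>s. wsum (\<lambda>k. c k * s ^ k) (p s n * p s m)) has_field_derivative 0) (at l)"
      by (rule has_field_derivative_transform_within_open
            [where S = "{0<..<1}" and f = "\<lambda>_. if n = m then 1 else 0"])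
         (use l wsum_orthonormal[OF orth] in auto)
  qed

  have LQ: "L (Q n * p l n) = coeff (Q n) n / coeff_a (p l) n" for n
    unfolding L_def by (subst wsum_mult_orthonormal[OF orl]) (auto simp: coeffQ)
  have diag: "coeff (Q n) n = - (coeff_a (p l) n * rec_B (p l) n) / (2 * l)" for n
  proof -
    have "2 * L (Q n * p l n) + rec_B (p l) n / l = 0"
      using key[of n n] rec_B_eq_wsum[OF orl, of n] by (simp add: L_def mult.commute)
    then show ?thesis using a[of n] l by (simp add: LQ field_simps)
  qed
  have Da: "((\<lambda>s. coeff_a (p s) n) has_field_derivative coeff (Q n) n) (at l)" for n
    using Q[of n] by (simp add: has_coeff_derivative_def coeff_a_def)
  show "((\<lambda>s. coeff_a (p s) n) has_field_derivative
          - (coeff_a (p l) n * rec_B (p l) n) / (2 * l)) (at l)"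
    using Da[of n] unfolding diag .

  show "((\<lambda>s. coeff_b (p s) n / coeff_a (p s) n) has_field_derivative
          - (rec_A (p l) n)\<^sup>2 / l) (at l)"
  proof (cases n)
    case 0
    then show ?thesis by (simp add: coeff_b_def rec_A_def)
  next
    case (Suc m)
    let ?a = "coeff_a (p l) (m + 1)" and ?b = "coeff_b (p l) (m + 1)"
    have "L (Q m * p l (m + 1)) = 0"
      unfolding L_def by (subst wsum_mult_orthonormal[OF orl]) (auto simp: coeffQ)
    moreover have "L (pCons 0 (p l (m + 1) * p l m)) = rec_A (p l) (m + 1)"
      using rec_A_eq_wsum[OF orl, of m] by (simp add: L_def mult.commute)
    ultimately have 1: "L (Q (m + 1) * p l m) = - rec_A (p l) (m + 1) / l"
      using key[of "m + 1" m] by (simp add: mult.commute)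
    have 2: "L (Q (m + 1) * p l m) =
        (coeff (Q (m + 1)) m - coeff (Q (m + 1)) (m + 1) * (?b / ?a)) / coeff_a (p l) m"
      unfolding L_def by (subst wsum_mult_orthonormal[OF orl]) (auto simp: coeffQ)
    have "((\<lambda>s. coeff_b (p s) (m + 1)) has_field_derivative coeff (Q (m + 1)) m) (at l)"
      using Q[of "m + 1"] by (simp add: has_coeff_derivative_def coeff_b_def)
    from DERIV_divide[OF this Da a]
    have "((\<lambda>s. coeff_b (p s) (m + 1) / coeff_a (p s) (m + 1)) has_field_derivative
       (coeff (Q (m + 1)) m * ?a - ?b * coeff (Q (m + 1)) (m + 1)) / (?a * ?a)) (at l)" .
    also have "(coeff (Q (m + 1)) m * ?a - ?b * coeff (Q (m + 1)) (m + 1)) / (?a * ?a) =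
        L (Q (m + 1) * p l m) * rec_A (p l) (m + 1)"
      using a[of "m + 1"] a[of m] unfolding 2 by (simp add: rec_A_def field_simps)
    also have "\<dots> = - (rec_A (p l) (m + 1))\<^sup>2 / l"
      unfolding 1 by (simp add: power2_eq_square)
    finally show ?thesis using Suc by simp
  qed
qed

lemma C1_on_Pair_field_differentiable:
  assumes "C1_on (\<lambda>(t, l). f t l :: real) S" "(t, l) \<in> S"
  shows "(\<lambda>s. f t s) field_differentiable at l"
proof -
  obtain f' where f': "((\<lambda>(t, l). f t l) has_derivative f') (at (t, l))"
    using assms unfolding C1_on_def by blast
  have "(Pair t has_derivative Pair 0) (at l)"
    by (auto intro!: derivative_eq_intros)
  from has_derivative_compose[OF this f'] have "(\<lambda>s. f t s) differentiable at l"
    unfolding differentiable_def by auto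
  then show ?thesis by (simp add: field_differentiable_def real_differentiable_def)
qed

theorem mainTheorem5:
  fixes \<nu> :: real
    and P :: "real \<Rightarrow> real \<Rightarrow> nat \<Rightarrow> real poly"
    and t l :: real
  assumes "\<nu> > -1"
    and orth: "\<And>t l. 0 < t \<Longrightarrow> 0 < l \<Longrightarrow> l < 1 \<Longrightarrow> orthonormal_polys (weight \<nu> t l) (P t l)"
    and C1: "\<And>n i. C1_on (\<lambda>(t, l). coeff (P t l n) i) ({0<..} \<times> {0<..<1})"
    and "0 < t" "0 < l" "l < 1"
  shows "(\<forall>n. (\<lambda>s. rec_B (P t s) n) field_differentiable at l \<and>
              l * deriv (\<lambda>s. rec_B (P t s) n) l
                = (rec_A (P t l) (n + 1))\<^sup>2 - (rec_A (P t l) n)\<^sup>2) \<and>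
         (\<forall>n\<ge>1. (\<lambda>s. (rec_A (P t s) n)\<^sup>2) field_differentiable at l \<and>
              l * deriv (\<lambda>s. (rec_A (P t s) n)\<^sup>2) l
                = (rec_A (P t l) n)\<^sup>2 * (rec_B (P t l) n - rec_B (P t l) (n - 1)))"
proof -
  define c where "c = (\<lambda>k. rho (real k + \<nu> + 1) t / fact k)"
  have orth': "orthonormal_polys (\<lambda>k. c k * s ^ k) (P t s)" if "0 < s" "s < 1" for s
  proof -
    have "(\<lambda>k. c k * s ^ k) = weight \<nu> t s" by (auto simp: c_def weight_def)
    then show ?thesis using orth[OF \<open>0 < t\<close> that] by simp
  qed
  have dif: "(\<lambda>s. coeff (P t s n) i) field_differentiable at l" for n i
    using C1_on_Pair_field_differentiable[OF C1, of t l] assms(4-6) by simp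
  have Da: "((\<lambda>s. coeff_a (P t s) n) has_field_derivative
      - (coeff_a (P t l) n * rec_B (P t l) n) / (2 * l)) (at l)" for n
    using orth' dif assms(5,6) by (rule has_derivative_coeff_a)
  have Dr: "((\<lambda>s. coeff_b (P t s) n / coeff_a (P t s) n) has_field_derivative
      - (rec_A (P t l) n)\<^sup>2 / l) (at l)" for n
    using orth' dif assms(5,6) by (rule has_derivative_coeff_ratio)
  have a: "coeff_a (P t l) n \<noteq> 0" for n
    using coeff_a_nonzero[OF orth'] assms(5,6) by blast
  have B: "((\<lambda>s. rec_B (P t s) n) has_field_derivative
      ((rec_A (P t l) (n + 1))\<^sup>2 - (rec_A (P t l) n)\<^sup>2) / l) (at l)" for n
    unfolding rec_B_def
    by (rule DERIV_cong[OF DERIV_diff[OF Dr Dr]]) (simp add: diff_divide_distrib)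
  have rec_A_Suc: "rec_A p (Suc m) = coeff_a p m / coeff_a p (Suc m)" for p m
    by (simp add: rec_A_def)
  have A: "((\<lambda>s. (rec_A (P t s) (Suc m))\<^sup>2) has_field_derivative
      (rec_A (P t l) (Suc m))\<^sup>2 * (rec_B (P t l) (Suc m) - rec_B (P t l) m) / l) (at l)" for m
  proof -
    have "((\<lambda>s. rec_A (P t s) (Suc m)) has_field_derivative
        rec_A (P t l) (Suc m) * (rec_B (P t l) (Suc m) - rec_B (P t l) m) / (2 * l)) (at l)"
      by (rule DERIV_cong[OF DERIV_divide[OF Da[of m] Da[of "Suc m"] a], folded rec_A_Suc])
         (use a[of m] a[of "Suc m"] \<open>0 < l\<close> in \<open>simp add: rec_A_Suc field_simps\<close>)
    from DERIV_power[OF this, of 2] show ?thesis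
      by (rule DERIV_cong) (simp add: power2_eq_square)
  qed
  have "(\<lambda>s. (rec_A (P t s) n)\<^sup>2) field_differentiable at l \<and>
      l * deriv (\<lambda>s. (rec_A (P t s) n)\<^sup>2) l
        = (rec_A (P t l) n)\<^sup>2 * (rec_B (P t l) n - rec_B (P t l) (n - 1))" if n: "n \<ge> 1" for n
  proof -
    obtain m where m: "n = Suc m" using n by (cases n) auto
    show ?thesis using A[of m] DERIV_imp_deriv[OF A[of m]] \<open>0 < l\<close>
      by (auto simp: m field_differentiable_def)
  qed
  moreover have "(\<lambda>s. rec_B (P t s) n) field_differentiable at l \<and>
      l * deriv (\<lambda>s. rec_B (P t s) n) l = (rec_A (P t l) (n + 1))\<^sup>2 - (rec_A (P t l) n)\<^sup>2" for n
    using B[of n] DERIV_imp_deriv[OF B[of n]] \<open>0 < l\<close> by (auto simp: field_differentiable_def)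
  ultimately show ?thesis by blast
qed

end
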